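(* Let $N \in \mathbb{N}$, let $p$ be a random variable uniformly distributed on $(0,1]$, and let $I_+ = \ln \frac{p}{1/N} = \ln (Np)$. Then for $n \ge 0$, $$\mathbf{P}\big[\,|I_+| \le n\,\big] = \begin{cases} \frac{2}{N}\sinh n, & n \le \ln N,\\[2pt] 1 - \frac{\cosh n - \sinh n}{N}, & n > \ln N.\end{cases}$$ So that, for $\alpha \in (0,1)$, if $\mathbf{P}\big[\,|I_+| > n\,\big] < \alpha$, then $$n > \begin{cases} \ln\left( \frac{(1-\alpha)N}{2} + \sqrt{\left(\frac{(1-\alpha)N}{2}\right)^2 + 1}\right), & \alpha \le \frac{1}{N},\\[4pt] -\ln(\alpha N), & \alpha > \frac{1}{N}.\end{cases}$$
   Context: Here $I_+$ is the active information, measured in nats (natural logarithm), of a given singleton in a finite space $\Omega = \{1,\dots,N\}$: the logarithm of the ratio of the probability $p$ of that singleton under an arbitrary alternative distribution on $\Omega$ to its probability $1/N$ under the uniform distribution on $\Omega$. The probability $p$ is itself treated as random. The second display is used to obtain the rejection threshold of a two-sided test at level $\alpha$ based on $|I_+|$. *)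

theory Defs
  imports "HOL-Probability.Probability"
begin

text \<open>
  Active information, in nats, of an event that has probability \<open>q\<close> under the reference
  distribution and probability \<open>p\<close> under the alternative one. Since \<open>ln 0 = 0\<close> and
  \<open>x / 0 = 0\<close> in HOL, the value is meaningful only for positive \<open>p\<close> and \<open>q\<close>.
\<close>

definition active_information :: "real \<Rightarrow> real \<Rightarrow> real" where
  "active_information q p = ln (p / q)"

lemma prob_singleton_uniform:
  assumes "x \<in> {1..N}"
  shows "measure_pmf.prob (pmf_of_set {1..N::nat}) {x} = 1 / real N"
  using assms by (subst measure_pmf_single, subst pmf_of_set) auto

lemma active_information_uniform:
  "active_information (1 / real N) p = ln (real N * p)"
  by (simp add: active_information_def mult.commute)

end

theory Submission
  imports Defs
begin

text \<open>
  For \<open>x > 0\<close> the condition \<open>\<bar>ln (N x)\<bar> \<le> n\<close> says that \<open>x\<close> lies in \<open>[exp (-n) / N, exp n / N]\<close>.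
  Under the uniform law on \<open>(0, 1]\<close> this interval is cut off at \<open>1\<close> and its probability is its
  length, so \<open>P(\<bar>I_+\<bar> \<le> n) = min (exp n / N) 1 - exp (-n) / N\<close>. The two cases of the distribution function are the two values of the minimum, because
  \<open>exp n \<le> N\<close> means \<open>n \<le> ln N\<close>.

  Bounding the minimum by its first entry gives \<open>P(\<bar>I_+\<bar> \<le> n) \<le> 2 sinh n / N\<close> for every
  \<open>n \<ge> 0\<close>, on both sides of \<open>ln N\<close>. A tail probability below \<open>\<alpha>\<close> therefore forces
  \<open>sinh n > (1 - \<alpha>) N / 2\<close>, and applying the increasing function \<open>arsinh\<close>, whose logarithmic form is
  the stated threshold, gives the bound on \<open>n\<close>. When \<open>\<alpha> > 1 / N\<close>, the threshold \<open>- ln (\<alpha> N)\<close> is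
  negative and the bound follows from \<open>n \<ge> 0\<close>.
\<close>

lemma abs_ln_le_iff:
  fixes x n :: real
  assumes "x > 0"
  shows "\<bar>ln x\<bar> \<le> n \<longleftrightarrow> exp (- n) \<le> x \<and> x \<le> exp n"
proof -
  have "\<bar>ln x\<bar> \<le> n \<longleftrightarrow> - n \<le> ln x \<and> ln x \<le> n"
    by auto
  also have "\<dots> \<longleftrightarrow> exp (- n) \<le> x \<and> x \<le> exp n"
    using assms by (metis exp_le_cancel_iff exp_ln)
  finally show ?thesis .
qed

text \<open>
  Passing to the law of \<open>p\<close> restricts attention to \<open>(0, 1]\<close>; this discards the points where \<open>p\<close> is
  not positive and the value of \<open>ln\<close> is a convention.
\<close>

lemma measure_abs_ln_uniform:
  fixes M :: "'a measure" and N n :: real and p :: "'a \<Rightarrow> real"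
  assumes N: "N \<ge> 1"
    and p: "p \<in> borel_measurable M"
    and law: "distr M borel p = uniform_measure lborel {0<..1}"
    and n: "n \<ge> 0"
  shows "measure M {\<omega> \<in> space M. \<bar>ln (N * p \<omega>)\<bar> \<le> n} = min (exp n / N) 1 - exp (- n) / N"
proof -
  define A where "A = {x. \<bar>ln (N * x)\<bar> \<le> n}"
  have A: "A \<in> sets borel"
    unfolding A_def by measurable
  have lower: "0 < exp (- n) / N"
    using N by simp
  have "exp (- n) / N \<le> exp n / N"
    using N n by (intro divide_right_mono) auto
  moreover have "exp (- n) / N \<le> 1"
    using N n by (simp add: order_trans[of _ 1])
  ultimately have ordered: "exp (- n) / N \<le> min (exp n / N) 1"
    by simp
  have "{0<..1} \<inter> A = {exp (- n) / N .. min (exp n / N) 1}"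
  proof (intro set_eqI)
    fix x :: real
    show "x \<in> {0<..1} \<inter> A \<longleftrightarrow> x \<in> {exp (- n) / N .. min (exp n / N) 1}"
    proof (cases "x > 0")
      case True
      then show ?thesis
        using N by (auto simp: A_def abs_ln_le_iff field_simps)
    next
      case False
      then show ?thesis
        using lower by auto
    qed
  qed
  then have "measure (uniform_measure lborel {0<..1}) A = min (exp n / N) 1 - exp (- n) / N"
    using A ordered by (subst measure_uniform_measure) auto
  moreover have "measure (distr M borel p) A = measure M (p -` A \<inter> space M)"
    using p A by (rule measure_distr)
  moreover have "p -` A \<inter> space M = {\<omega> \<in> space M. \<bar>ln (N * p \<omega>)\<bar> \<le> n}"
    by (auto simp: A_def)
  ultimately show ?thesis
    by (simp add: law)
qed

theorem mainTheorem2: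
  fixes M :: "'a measure" and N :: nat and p Iplus :: "'a \<Rightarrow> real" and n :: real
  assumes "prob_space M"
    and "N \<ge> 1"
    and "p \<in> borel_measurable M"
    and "distr M borel p = uniform_measure lborel {0<..1}"
    and "Iplus = (\<lambda>\<omega>. active_information (1 / real N) (p \<omega>))"
    and "n \<ge> 0"
  shows "measure M {\<omega> \<in> space M. \<bar>Iplus \<omega>\<bar> \<le> n} =
           (if n \<le> ln (real N) then 2 / real N * sinh n
            else 1 - (cosh n - sinh n) / real N)
       \<and> (\<forall>\<alpha>::real. 0 < \<alpha> \<and> \<alpha> < 1 \<and> measure M {\<omega> \<in> space M. \<bar>Iplus \<omega>\<bar> > n} < \<alpha> \<longrightarrow>
            n > (if \<alpha> \<le> 1 / real N
                 then ln ((1 - \<alpha>) * real N / 2 + sqrt (((1 - \<alpha>) * real N / 2)\<^sup>2 + 1))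
                 else - ln (\<alpha> * real N)))"
proof (intro conjI allI impI)
  interpret prob_space M
    by fact
  have N: "real N \<ge> 1"
    using assms(2) by simp
  have Iplus: "Iplus \<omega> = ln (real N * p \<omega>)" for \<omega>
    by (simp add: assms(5) active_information_uniform)
  have meas: "{\<omega> \<in> space M. \<bar>Iplus \<omega>\<bar> \<le> n} \<in> sets M"
    unfolding Iplus using assms(3) by measurable
  have cdf: "prob {\<omega> \<in> space M. \<bar>Iplus \<omega>\<bar> \<le> n} = min (exp n / N) 1 - exp (- n) / N"
    unfolding Iplus using N assms(3,4,6) by (rule measure_abs_ln_uniform)
  have sinh: "2 / real N * sinh n = exp n / N - exp (- n) / N"
    by (simp add: sinh_field_def diff_divide_distrib)
  have "n \<le> ln N \<longleftrightarrow> exp n / N \<le> 1"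
    using N by (simp add: ln_ge_iff)
  then show "prob {\<omega> \<in> space M. \<bar>Iplus \<omega>\<bar> \<le> n} =
      (if n \<le> ln (real N) then 2 / real N * sinh n else 1 - (cosh n - sinh n) / real N)"
    by (simp only: cdf sinh cosh_minus_sinh min_def if_distrib split: if_split)
      simp
  fix \<alpha> :: real
  assume \<alpha>: "0 < \<alpha> \<and> \<alpha> < 1 \<and> prob {\<omega> \<in> space M. \<bar>Iplus \<omega>\<bar> > n} < \<alpha>"
  show "n > (if \<alpha> \<le> 1 / real N
      then ln ((1 - \<alpha>) * real N / 2 + sqrt (((1 - \<alpha>) * real N / 2)\<^sup>2 + 1))
      else - ln (\<alpha> * real N))"
  proof (cases "\<alpha> \<le> 1 / N")
    case True
    have "{\<omega> \<in> space M. \<bar>Iplus \<omega>\<bar> > n} = space M - {\<omega> \<in> space M. \<bar>Iplus \<omega>\<bar> \<le> n}"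
      by auto
    then have "1 - \<alpha> < prob {\<omega> \<in> space M. \<bar>Iplus \<omega>\<bar> \<le> n}"
      using \<alpha> prob_compl[OF meas] by simp
    also have "\<dots> \<le> 2 / real N * sinh n"
      unfolding cdf sinh by simp
    finally have "(1 - \<alpha>) * N / 2 < sinh n"
      using N by (simp add: field_simps)
    then have "arsinh ((1 - \<alpha>) * N / 2) < n"
      by (metis arsinh_less_iff_real arsinh_sinh_real)
    then show ?thesis
      using True by (simp add: arsinh_real_def)
  next
    case False
    then have "\<alpha> * N > 1"
      using N by (simp add: field_simps)
    then have "- ln (\<alpha> * N) < 0"
      by simp
    then show ?thesis
      using False assms(6) by simp
  qed
qed

end
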